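(* Let $d\ge 1$ be an integer and let $\Gamma$ be a (finite, simple) graph on $d$ nodes. Then $\Gamma$ is isomorphic to an induced subgraph of the skeleton of some binary, combinatorial, convex polytope of dimension $d$.
   Context: Graphs have neither loops nor multiple links. A convex polytope in some $\mathbb{R}^m$ is binary if all its vertices have all coordinates equal to $0$ or $1$. A convex polytope is combinatorial if it is binary and, for every two (distinct) nonadjacent vertices, their midpoint equals the midpoint of two other vertices. The skeleton (or graph) of a polytope is the graph whose nodes are the vertices of the polytope, two vertices being adjacent when they are the endpoints of an edge (1-dimensional face) of the polytope. *)

theory Defs
  imports "HOL-Analysis.Analysis" "HOL-Analysis.Finite_Function_Topology"
begin

text \<open>A graph is a pair of a node set and an edge set; edges are two-element sets of nodes,
  so there are neither loops nor multiple links.\<close>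

type_synonym 'a graph = "'a set \<times> 'a set set"

definition finite_simple_graph :: "'a graph \<Rightarrow> bool" where
  "finite_simple_graph G \<longleftrightarrow> finite (fst G) \<and> (\<forall>e\<in>snd G. e \<subseteq> fst G \<and> card e = 2)"

definition induced_subgraph :: "'a graph \<Rightarrow> 'a graph \<Rightarrow> bool" where
  "induced_subgraph H G \<longleftrightarrow> fst H \<subseteq> fst G \<and> snd H = {e \<in> snd G. e \<subseteq> fst H}"

definition graph_isomorphic :: "'a graph \<Rightarrow> 'b graph \<Rightarrow> bool" where
  "graph_isomorphic G H \<longleftrightarrow>
     (\<exists>f. bij_betw f (fst G) (fst H) \<and>
          (\<forall>u\<in>fst G. \<forall>v\<in>fst G. {u, v} \<in> snd G \<longleftrightarrow> {f u, f v} \<in> snd H))"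

text \<open>To allow quantification over \<open>m\<close> inside a formula, \<open>\<real>\<^sup>m\<close> is the subspace of the real vector
  space of finitely supported sequences whose coordinates with index \<open>\<ge> m\<close> vanish.\<close>

definition coord_space :: "nat \<Rightarrow> (nat \<Rightarrow>\<^sub>0 real) set" where
  "coord_space m = {x. Poly_Mapping.keys x \<subseteq> {..<m}}"

text \<open>The library's \<open>aff_dim\<close> needs a Euclidean space; this is the same notion for an arbitrary
  real vector space.\<close>

definition has_dimension :: "'a::real_vector set \<Rightarrow> nat \<Rightarrow> bool" where
  "has_dimension S n \<longleftrightarrow>
     (\<exists>B. affine hull B = affine hull S \<and> \<not> affine_dependent B \<and> card B = n + 1)"

lemma has_dimension_iff_aff_dim:
  fixes S :: "'a::euclidean_space set"
  shows "has_dimension S n \<longleftrightarrow> aff_dim S = int n"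
proof
  assume "has_dimension S n"
  then obtain B where B: "affine hull B = affine hull S" "\<not> affine_dependent B" "card B = n + 1"
    unfolding has_dimension_def by blast
  then have "int (card B) = aff_dim S + 1"
    using aff_dim_unique by blast
  with B show "aff_dim S = int n" by simp
next
  assume *: "aff_dim S = int n"
  obtain B where B: "affine hull B = affine hull S \<and> \<not> affine_dependent B \<and>
      int (card B) = aff_dim S + 1"
    using aff_dim_basis_exists[of S] ..
  then have "card B = n + 1" using * by linarith
  with B show "has_dimension S n"
    unfolding has_dimension_def by blast
qed

definition edge_of_polytope :: "'a::real_vector set \<Rightarrow> 'a set \<Rightarrow> bool" where
  "edge_of_polytope e P \<longleftrightarrow> e face_of P \<and> has_dimension e 1"

definition skeleton :: "'a::real_vector set \<Rightarrow> 'a graph" where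
  "skeleton P =
     ({v. v extreme_point_of P}, {{u, v} | u v. edge_of_polytope (closed_segment u v) P})"

lemma endpoint_extreme_point_of_segment:
  "u extreme_point_of closed_segment u v"
  unfolding extreme_point_of_def
proof (intro conjI ballI notI)
  fix a b
  assume "a \<in> closed_segment u v" "b \<in> closed_segment u v"
  moreover have "\<exists>s. x = u + s *\<^sub>R (v - u) \<and> 0 \<le> s" if "x \<in> closed_segment u v" for x
  proof -
    from that obtain s where "x = (1 - s) *\<^sub>R u + s *\<^sub>R v" "0 \<le> s"
      by (auto simp: in_segment)
    then show ?thesis by (intro exI[of _ s]) (simp add: algebra_simps)
  qed
  ultimately have "\<exists>s. a = u + s *\<^sub>R (v - u) \<and> 0 \<le> s" "\<exists>s. b = u + s *\<^sub>R (v - u) \<and> 0 \<le> s"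
    by simp_all
  then obtain s t where s: "a = u + s *\<^sub>R (v - u)" "0 \<le> s"
    and t: "b = u + t *\<^sub>R (v - u)" "0 \<le> t"
    by blast
  assume "u \<in> open_segment a b"
  then obtain r where r: "0 < r" "r < 1" "a \<noteq> b" "u = (1 - r) *\<^sub>R a + r *\<^sub>R b"
    by (auto simp: in_segment)
  have "((1 - r) * s + r * t) *\<^sub>R (v - u) = ((1 - r) *\<^sub>R a + r *\<^sub>R b) - u"
    by (simp add: s t algebra_simps)
  also have "\<dots> = 0" using r(4) by (metis diff_self)
  finally have "(1 - r) * s + r * t = 0 \<or> v = u" by simp
  moreover have "v \<noteq> u" using r(3) s(1) t(1) by auto
  moreover have "0 \<le> (1 - r) * s" "0 \<le> r * t" using r(1,2) s(2) t(2) by auto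
  ultimately have "(1 - r) * s = 0" "r * t = 0" by linarith+
  then have "s = 0" "t = 0" using r(1,2) by auto
  then show False using r(3) s(1) t(1) by simp
qed simp

lemma skeleton_finite_simple_graph:
  assumes "polytope P"
  shows "finite_simple_graph (skeleton P)"
proof -
  obtain S where S: "finite S" "P = convex hull S"
    using assms unfolding polytope_def by blast
  have "finite {v. v extreme_point_of P}"
    by (rule finite_subset[OF _ S(1)]) (auto simp: S(2) dest: extreme_point_of_convex_hull)
  moreover have "{u, v} \<subseteq> {v. v extreme_point_of P} \<and> card {u, v} = 2"
    if e: "edge_of_polytope (closed_segment u v) P" for u v
  proof -
    have "u extreme_point_of P" "v extreme_point_of P"
      using e extreme_point_of_face[of "closed_segment u v" P]
        endpoint_extreme_point_of_segment[of u v]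
        endpoint_extreme_point_of_segment[of v u, unfolded closed_segment_commute[of v u]]
      unfolding edge_of_polytope_def by blast+
    moreover have "u \<noteq> v"
    proof
      assume "u = v"
      then obtain B where B: "affine hull B = affine hull {u}" "card B = 1 + 1"
        using e unfolding edge_of_polytope_def has_dimension_def by auto
      then have "B \<subseteq> {u}"
        using hull_subset[of B affine] hull_same[of affine "{u}"] affine_sing[of u] by metis
      then have "card B \<le> card {u}"
        by (intro card_mono) auto
      with B show False by simp
    qed
    ultimately show ?thesis by simp
  qed
  ultimately show ?thesis
    unfolding finite_simple_graph_def skeleton_def by auto
qed

definition binary_polytope :: "(nat \<Rightarrow>\<^sub>0 real) set \<Rightarrow> bool" where
  "binary_polytope P \<longleftrightarrow> (\<forall>v. v extreme_point_of P \<longrightarrow> (\<forall>i. Poly_Mapping.lookup v i \<in> {0, 1}))"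

definition combinatorial_polytope :: "(nat \<Rightarrow>\<^sub>0 real) set \<Rightarrow> bool" where
  "combinatorial_polytope P \<longleftrightarrow> binary_polytope P \<and>
     (\<forall>u v. u extreme_point_of P \<and> v extreme_point_of P \<and> u \<noteq> v \<and> {u, v} \<notin> snd (skeleton P) \<longrightarrow>
        (\<exists>w z. w extreme_point_of P \<and> z extreme_point_of P \<and> w \<noteq> z \<and>
               w \<notin> {u, v} \<and> z \<notin> {u, v} \<and> midpoint u v = midpoint w z))"

end

theory Submission
  imports Defs
begin

text \<open>
  The polytope is the stable set polytope of \<open>\<Gamma>\<close> itself: the convex hull of the 0/1 incidence
  vectors of the sets of nodes that span no link. The empty set and the singletons are stable, so
  the polytope contains the origin and the \<open>d\<close> unit vectors, and its dimension is \<open>d\<close>.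

  Its adjacencies are governed by Chvatal's criterion (\<open>adjacent_iff_connected\<close>): the
  vertices of two stable sets \<open>S\<close> and \<open>T\<close> are adjacent exactly if the symmetric difference of
  \<open>S\<close> and \<open>T\<close> induces a connected subgraph.
  \<^item> If it is disconnected, exchanging \<open>S\<close> and \<open>T\<close> on a union of components yields two other
    stable sets with the same midpoint (\<open>exchange_of_disconnected\<close>). This prevents adjacency,
    and it is also the combinatorial property.
  \<^item> If it is connected, the constraint \<open>x\<^sub>i + x\<^sub>j \<le> 1\<close> is tight on the segment for each of its
    links \<open>ij\<close>. Two points of the polytope whose open segment meets the segment of \<open>S\<close> and \<open>T\<close>
    must satisfy the same equations, and connectedness leaves them a single degree of freedom, so
    both lie on that segment (\<open>segment_face_of_stable_set_polytope\<close>).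

  For two singletons \<open>{u}\<close> and \<open>{v}\<close> the symmetric difference is \<open>{u, v}\<close>, which is connected
  exactly if \<open>u\<close> and \<open>v\<close> are linked in \<open>\<Gamma>\<close>. Hence the unit vectors span a copy of \<open>\<Gamma>\<close> in the
  skeleton.
\<close>

section \<open>Stable sets and their incidence vectors\<close>

definition stable_sets :: "'a graph \<Rightarrow> 'a set set" where
  "stable_sets G = {S. S \<subseteq> fst G \<and> (\<forall>e\<in>snd G. \<not> e \<subseteq> S)}"

definition incidence_vector :: "'a set \<Rightarrow> ('a \<Rightarrow>\<^sub>0 real)" where
  "incidence_vector S = (\<Sum>i\<in>S. Poly_Mapping.single i 1)"

definition stable_set_polytope :: "'a graph \<Rightarrow> ('a \<Rightarrow>\<^sub>0 real) set" where
  "stable_set_polytope G = convex hull (incidence_vector ` stable_sets G)"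

text \<open>Stated by cuts rather than by paths: the cut formulation is both what the exchange
  argument needs when it fails and what propagates an equation from one node to all others when it
  holds.\<close>

definition connected_on :: "'a graph \<Rightarrow> 'a set \<Rightarrow> bool" where
  "connected_on G D \<longleftrightarrow> (\<forall>C\<subseteq>D. (\<forall>i\<in>C. \<forall>j\<in>D - C. {i, j} \<notin> snd G) \<longrightarrow> C = {} \<or> C = D)"

lemma lookup_scaleR:
  "Poly_Mapping.lookup (r *\<^sub>R x) i = r *\<^sub>R Poly_Mapping.lookup x i"
proof -
  have "finite {i. r *\<^sub>R Poly_Mapping.lookup x i \<noteq> 0}"
    by (rule finite_subset[OF _ finite_lookup[of x]]) auto
  then show ?thesis
    by (simp add: scaleR_poly_mapping_def)
qed

lemma linear_lookup:
  "linear (\<lambda>x :: 'a \<Rightarrow>\<^sub>0 'b::real_vector. Poly_Mapping.lookup x i)"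
  by (rule linearI) (simp_all add: lookup_add lookup_scaleR)

lemma lookup_incidence_vector:
  assumes "finite S"
  shows "Poly_Mapping.lookup (incidence_vector S) i = (if i \<in> S then 1 else 0)"
  using assms by (simp add: incidence_vector_def lookup_sum lookup_single when_def)

lemma incidence_vector_eq_iff:
  assumes "finite S" "finite T"
  shows "incidence_vector S = incidence_vector T \<longleftrightarrow> S = T"
proof
  assume "incidence_vector S = incidence_vector T"
  then have "(if i \<in> S then 1 else 0) = (if i \<in> T then 1 else (0::real))" for i
    using assms by (metis lookup_incidence_vector)
  then show "S = T"
    by (metis one_neq_zero subsetI subset_antisym)
qed simp

lemma finite_stable_set:
  assumes "finite_simple_graph G" "S \<in> stable_sets G"
  shows "finite S"
  using assms by (auto simp: finite_simple_graph_def stable_sets_def intro: finite_subset)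

lemma finite_stable_sets:
  assumes "finite_simple_graph G"
  shows "finite (stable_sets G)"
  by (rule finite_subset[of _ "Pow (fst G)"])
    (use assms in \<open>auto simp: finite_simple_graph_def stable_sets_def\<close>)

lemma stable_sets_no_link:
  assumes "S \<in> stable_sets G" "i \<in> S" "j \<in> S"
  shows "{i, j} \<notin> snd G"
  using assms by (auto simp: stable_sets_def)

lemma empty_in_stable_sets:
  assumes "finite_simple_graph G"
  shows "{} \<in> stable_sets G"
  using assms by (auto simp: finite_simple_graph_def stable_sets_def)

lemma singleton_in_stable_sets:
  assumes "finite_simple_graph G" "i \<in> fst G"
  shows "{i} \<in> stable_sets G"
proof -
  have "\<not> e \<subseteq> {i}" if "e \<in> snd G" for e
  proof
    assume "e \<subseteq> {i}"
    then have "card e \<le> card {i}" by (intro card_mono) auto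
    with that assms(1) show False by (auto simp: finite_simple_graph_def)
  qed
  with assms(2) show ?thesis by (auto simp: stable_sets_def)
qed

lemma connected_on_doubleton:
  assumes "u \<noteq> v"
  shows "connected_on G {u, v} \<longleftrightarrow> {u, v} \<in> snd G"
proof
  assume "connected_on G {u, v}"
  then have "\<not> (\<forall>i\<in>{u}. \<forall>j\<in>{u, v} - {u}. {i, j} \<notin> snd G)"
    unfolding connected_on_def using assms by (elim allE[of _ "{u}"]) auto
  then show "{u, v} \<in> snd G" using assms by auto
next
  assume uv: "{u, v} \<in> snd G"
  show "connected_on G {u, v}"
    unfolding connected_on_def
  proof (intro allI impI)
    fix C assume C: "C \<subseteq> {u, v}" "\<forall>i\<in>C. \<forall>j\<in>{u, v} - C. {i, j} \<notin> snd G"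
    have "u \<in> C \<longleftrightarrow> v \<in> C" using C(2) uv by (metis Diff_iff insertCI insert_commute)
    with C(1) show "C = {} \<or> C = {u, v}" by auto
  qed
qed

section \<open>Valid inequalities and vertices of the stable set polytope\<close>

lemma polytope_stable_set_polytope:
  assumes "finite_simple_graph G"
  shows "polytope (stable_set_polytope G)"
  unfolding polytope_def stable_set_polytope_def using finite_stable_sets[OF assms] by blast

lemma incidence_vector_in_stable_set_polytope:
  assumes "S \<in> stable_sets G"
  shows "incidence_vector S \<in> stable_set_polytope G"
  unfolding stable_set_polytope_def using assms by (simp add: hull_inc)

lemma stable_set_polytope_bound:
  fixes f :: "('a \<Rightarrow>\<^sub>0 real) \<Rightarrow> real"
  assumes "linear f" "\<And>S. S \<in> stable_sets G \<Longrightarrow> f (incidence_vector S) \<le> c"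
    and "x \<in> stable_set_polytope G"
  shows "f x \<le> c"
proof -
  have "stable_set_polytope G \<subseteq> f -` {..c}"
    unfolding stable_set_polytope_def
    by (rule hull_minimal) (use assms(1,2) in \<open>auto intro!: convex_linear_vimage\<close>)
  with assms(3) show ?thesis by auto
qed

lemma stable_set_polytope_constraints:
  assumes G: "finite_simple_graph G" and x: "x \<in> stable_set_polytope G"
  shows stable_set_polytope_nonneg: "0 \<le> Poly_Mapping.lookup x i"
    and stable_set_polytope_le_1: "Poly_Mapping.lookup x i \<le> 1"
    and stable_set_polytope_outside: "i \<notin> fst G \<Longrightarrow> Poly_Mapping.lookup x i = 0"
    and stable_set_polytope_link:
      "{i, j} \<in> snd G \<Longrightarrow> Poly_Mapping.lookup x i + Poly_Mapping.lookup x j \<le> 1"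
proof -
  note inc = lookup_incidence_vector[OF finite_stable_set[OF G]]
  have neg: "linear (\<lambda>x :: 'a \<Rightarrow>\<^sub>0 real. - Poly_Mapping.lookup x i)"
    by (intro linear_compose_neg linear_lookup)
  have "- Poly_Mapping.lookup x i \<le> 0"
    by (rule stable_set_polytope_bound[OF neg _ x]) (simp add: inc)
  then show nonneg: "0 \<le> Poly_Mapping.lookup x i" by simp
  show "Poly_Mapping.lookup x i \<le> 1"
    by (rule stable_set_polytope_bound[OF linear_lookup _ x]) (simp add: inc)
  show "Poly_Mapping.lookup x i = 0" if "i \<notin> fst G"
  proof -
    have "Poly_Mapping.lookup x i \<le> 0"
      by (rule stable_set_polytope_bound[OF linear_lookup _ x])
        (use that in \<open>auto simp: inc stable_sets_def\<close>)
    with nonneg show ?thesis by simp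
  qed
  show "Poly_Mapping.lookup x i + Poly_Mapping.lookup x j \<le> 1" if "{i, j} \<in> snd G"
    by (rule stable_set_polytope_bound[OF linear_compose_add[OF linear_lookup linear_lookup] _ x])
      (use that in \<open>auto simp: inc dest: stable_sets_no_link\<close>)
qed

lemma convex_combination_tight:
  fixes p q u c :: real
  assumes "(1 - u) * p + u * q = c" "p \<le> c" "q \<le> c" "0 < u" "u < 1"
  shows "p = c"
proof (rule ccontr)
  assume "p \<noteq> c"
  then have "(1 - u) * p < (1 - u) * c" using assms by simp
  moreover have "u * q \<le> u * c" using assms by simp
  ultimately have "(1 - u) * p + u * q < (1 - u) * c + u * c" by linarith
  also have "\<dots> = c" by (simp add: algebra_simps)
  finally show False using assms(1) by simp
qed

text \<open>The source of all facial arguments below, both for vertices and for edges: the inequalities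
  valid on the polytope that are tight at a point are tight at the ends of every segment of the
  polytope through it.\<close>

lemma open_segment_tight:
  fixes f :: "'a::real_vector \<Rightarrow> real"
  assumes "linear f" "x \<in> open_segment a b" "f a \<le> c" "f b \<le> c" "f x = c"
  shows "f a = c"
proof -
  obtain u where u: "0 < u" "u < 1" "x = (1 - u) *\<^sub>R a + u *\<^sub>R b"
    using assms(2) by (auto simp: in_segment)
  have "(1 - u) * f a + u * f b = c"
    using assms(1,5) by (simp add: u(3) linear_add linear_cmul)
  then show ?thesis
    using convex_combination_tight assms(3,4) u(1,2) by blast
qed

text \<open>Both 0 and 1 are extreme values of a coordinate on the polytope, so such a value determines
  the coordinate at the ends of the segment.\<close>

lemma open_segment_coordinate:
  assumes G: "finite_simple_graph G"
    and ab: "a \<in> stable_set_polytope G" "b \<in> stable_set_polytope G" "x \<in> open_segment a b"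
    and xi: "Poly_Mapping.lookup x i \<in> {0, 1}"
  shows "Poly_Mapping.lookup a i = Poly_Mapping.lookup x i"
proof (cases "Poly_Mapping.lookup x i = 1")
  case True
  then show ?thesis
    using open_segment_tight[OF linear_lookup ab(3)] stable_set_polytope_le_1[OF G] ab(1,2) by simp
next
  case False
  with xi have "- Poly_Mapping.lookup x i = 0" by simp
  then have "- Poly_Mapping.lookup a i = 0"
    by (rule open_segment_tight[OF linear_compose_neg[OF linear_lookup] ab(3), rotated 2])
      (use ab(1,2) stable_set_polytope_nonneg[OF G] in simp_all)
  with \<open>- Poly_Mapping.lookup x i = 0\<close> show ?thesis by simp
qed

lemma extreme_point_of_stable_set_polytope:
  assumes G: "finite_simple_graph G"
  shows "v extreme_point_of stable_set_polytope G \<longleftrightarrow> v \<in> incidence_vector ` stable_sets G"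
proof
  assume "v extreme_point_of stable_set_polytope G"
  then show "v \<in> incidence_vector ` stable_sets G"
    unfolding stable_set_polytope_def by (rule extreme_point_of_convex_hull)
next
  assume "v \<in> incidence_vector ` stable_sets G"
  then obtain S where S: "S \<in> stable_sets G" "v = incidence_vector S" by blast
  have coord: "Poly_Mapping.lookup v i \<in> {0, 1}" for i
    using lookup_incidence_vector[OF finite_stable_set[OF G S(1)]] by (simp add: S(2))
  have end_eq: "a = v"
    if "a \<in> stable_set_polytope G" "b \<in> stable_set_polytope G" "v \<in> open_segment a b" for a b
    by (rule poly_mapping_eqI) (rule open_segment_coordinate[OF G that coord])
  have "v \<notin> open_segment a b"
    if "a \<in> stable_set_polytope G" "b \<in> stable_set_polytope G" for a b
  proof
    assume v: "v \<in> open_segment a b"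
    with that have "a = v" "b = v"
      using end_eq[of a b] end_eq[of b a] by (auto simp: open_segment_commute)
    with v show False by simp
  qed
  then show "v extreme_point_of stable_set_polytope G"
    unfolding extreme_point_of_def
    using incidence_vector_in_stable_set_polytope[OF S(1)] S(2) by blast
qed

section \<open>Adjacency of vertices\<close>

text \<open>Along the segment, the coordinates in \<open>S - T\<close> all equal one parameter and those in \<open>T - S\<close>
  its complement to 1. The point of the proof is that this holds for \<open>a\<close> as well: the nodes of
  the symmetric difference at which \<open>a\<close> has the same parameter as at a fixed node are closed under
  links, because the link constraints are tight, so by connectedness they are all of it.\<close>

lemma segment_end_in_segment:
  assumes G: "finite_simple_graph G"
    and S: "S \<in> stable_sets G" and T: "T \<in> stable_sets G" and "S \<noteq> T"
    and conn: "connected_on G ((S - T) \<union> (T - S))"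
    and ab: "a \<in> stable_set_polytope G" "b \<in> stable_set_polytope G" "x \<in> open_segment a b"
    and x: "x \<in> closed_segment (incidence_vector S) (incidence_vector T)"
  shows "a \<in> closed_segment (incidence_vector S) (incidence_vector T)"
proof -
  define D where "D = (S - T) \<union> (T - S)"
  define y where "y i = (if i \<in> S then Poly_Mapping.lookup a i else 1 - Poly_Mapping.lookup a i)"
    for i
  note inc = lookup_incidence_vector[OF finite_stable_set[OF G S]]
    lookup_incidence_vector[OF finite_stable_set[OF G T]]
  obtain t where t: "x = (1 - t) *\<^sub>R incidence_vector S + t *\<^sub>R incidence_vector T"
    using x by (auto simp: in_segment)
  have lookup_x: "Poly_Mapping.lookup x i = (1 - t) * of_bool (i \<in> S) + t * of_bool (i \<in> T)" for i
    by (simp add: t lookup_add lookup_scaleR inc)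
  have link: "y i = y j" if ij: "i \<in> D" "j \<in> D" "{i, j} \<in> snd G" for i j
  proof -
    have cases: "i \<in> S - T \<and> j \<in> T - S \<or> i \<in> T - S \<and> j \<in> S - T"
      using ij stable_sets_no_link[OF S] stable_sets_no_link[OF T] by (auto simp: D_def)
    then have "Poly_Mapping.lookup x i + Poly_Mapping.lookup x j = 1"
      by (auto simp: lookup_x)
    then have "Poly_Mapping.lookup a i + Poly_Mapping.lookup a j = 1"
      by (rule open_segment_tight[OF linear_compose_add[OF linear_lookup linear_lookup] ab(3),
            rotated 2])
        (use ab(1,2) stable_set_polytope_link[OF G _ ij(3)] in simp_all)
    with cases show ?thesis by (auto simp: y_def)
  qed
  obtain k where k: "k \<in> D" using \<open>S \<noteq> T\<close> by (auto simp: D_def)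
  have "{i \<in> D. y i = y k} = D"
  proof -
    have "\<forall>i\<in>{i \<in> D. y i = y k}. \<forall>j\<in>D - {i \<in> D. y i = y k}. {i, j} \<notin> snd G"
      using link by fastforce
    then have "{i \<in> D. y i = y k} = {} \<or> {i \<in> D. y i = y k} = D"
      using conn unfolding connected_on_def D_def[symmetric]
      by (elim allE[of _ "{i \<in> D. y i = y k}"]) auto
    with k show ?thesis by auto
  qed
  then have const: "y i = y k" if "i \<in> D" for i using that by blast
  have "a = (1 - (1 - y k)) *\<^sub>R incidence_vector S + (1 - y k) *\<^sub>R incidence_vector T"
  proof (rule poly_mapping_eqI)
    fix i
    have "Poly_Mapping.lookup a i = y k * of_bool (i \<in> S) + (1 - y k) * of_bool (i \<in> T)"
    proof (cases "i \<in> D")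
      case True
      with const[OF True] show ?thesis by (auto simp: y_def D_def)
    next
      case False
      then have "Poly_Mapping.lookup x i = of_bool (i \<in> S)" "i \<in> S \<longleftrightarrow> i \<in> T"
        by (auto simp: D_def lookup_x)
      with open_segment_coordinate[OF G ab, of i] show ?thesis by (cases "i \<in> S") auto
    qed
    then show "Poly_Mapping.lookup a i = Poly_Mapping.lookup
        ((1 - (1 - y k)) *\<^sub>R incidence_vector S + (1 - y k) *\<^sub>R incidence_vector T) i"
      by (simp add: lookup_add lookup_scaleR inc)
  qed
  moreover have "0 \<le> 1 - y k" "1 - y k \<le> 1"
    using stable_set_polytope_nonneg[OF G ab(1)] stable_set_polytope_le_1[OF G ab(1)]
    by (auto simp: y_def)
  ultimately show ?thesis unfolding in_segment by blast
qed

lemma segment_face_of_stable_set_polytope: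
  assumes G: "finite_simple_graph G"
    and S: "S \<in> stable_sets G" and T: "T \<in> stable_sets G" and "S \<noteq> T"
    and conn: "connected_on G ((S - T) \<union> (T - S))"
  shows "closed_segment (incidence_vector S) (incidence_vector T) face_of stable_set_polytope G"
  unfolding face_of_def
proof (intro conjI ballI impI)
  have "convex (stable_set_polytope G)" by (simp add: stable_set_polytope_def)
  then show "closed_segment (incidence_vector S) (incidence_vector T) \<subseteq> stable_set_polytope G"
    by (intro closed_segment_subset incidence_vector_in_stable_set_polytope S T)
  show "convex (closed_segment (incidence_vector S) (incidence_vector T))" by simp
  fix a b x
  assume ab: "a \<in> stable_set_polytope G" "b \<in> stable_set_polytope G"
    and x: "x \<in> closed_segment (incidence_vector S) (incidence_vector T)" "x \<in> open_segment a b"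
  note in_seg = segment_end_in_segment[OF G S T \<open>S \<noteq> T\<close> conn]
  show "a \<in> closed_segment (incidence_vector S) (incidence_vector T)"
    using in_seg[OF ab x(2,1)] .
  show "b \<in> closed_segment (incidence_vector S) (incidence_vector T)"
    using in_seg[OF ab(2,1) _ x(1)] x(2) by (simp add: open_segment_commute)
qed

text \<open>The exchange replaces \<open>S\<close> and \<open>T\<close> by their symmetric differences with one side \<open>C\<close> of a
  cut without links. The results are stable: a link in the set obtained from \<open>S\<close> would join a node
  of \<open>S\<close> outside \<open>C\<close> to a node of \<open>T\<close> in \<open>C\<close>, so either it lies in the stable set \<open>T\<close> or it
  crosses the cut.\<close>

lemma exchange_of_disconnected:
  assumes G: "finite_simple_graph G"
    and S: "S \<in> stable_sets G" and T: "T \<in> stable_sets G"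
    and "\<not> connected_on G ((S - T) \<union> (T - S))"
  obtains W Z where "W \<in> stable_sets G" "Z \<in> stable_sets G" "W \<noteq> Z" "W \<notin> {S, T}" "Z \<notin> {S, T}"
    "midpoint (incidence_vector S) (incidence_vector T) =
      midpoint (incidence_vector W) (incidence_vector Z)"
proof -
  define D where "D = (S - T) \<union> (T - S)"
  have "\<not> connected_on G D" using assms(4) by (simp add: D_def)
  then obtain C where C: "C \<subseteq> D" "C \<noteq> {}" "C \<noteq> D"
    and cut: "\<And>i j. i \<in> C \<Longrightarrow> j \<in> D - C \<Longrightarrow> {i, j} \<notin> snd G"
    unfolding connected_on_def by metis
  have exchange: "(S' - C) \<union> (C - S') \<in> stable_sets G"
    if "S' = S \<and> T' = T \<or> S' = T \<and> T' = S" for S' T'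
  proof -
    have S': "S' \<in> stable_sets G" "T' \<in> stable_sets G" using that S T by auto
    have no_link: "{i, j} \<notin> snd G" if ij: "i \<in> S' - C" "j \<in> C - S'" for i j
    proof (cases "i \<in> T'")
      case True
      have "j \<in> T'" using ij C(1) D_def \<open>S' = S \<and> T' = T \<or> S' = T \<and> T' = S\<close> by auto
      with True show ?thesis using stable_sets_no_link[OF S'(2)] by blast
    next
      case False
      then have "i \<in> D - C"
        using ij(1) D_def \<open>S' = S \<and> T' = T \<or> S' = T \<and> T' = S\<close> by auto
      then have "{j, i} \<notin> snd G" using cut ij(2) by blast
      then show ?thesis by (simp add: insert_commute)
    qed
    have "C - S' \<subseteq> T'" using C(1) D_def that by auto
    have "\<not> e \<subseteq> (S' - C) \<union> (C - S')" if e: "e \<in> snd G" for e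
    proof
      assume sub: "e \<subseteq> (S' - C) \<union> (C - S')"
      obtain i j where ij: "e = {i, j}"
        using G e unfolding finite_simple_graph_def by (auto simp: card_2_iff)
      with sub consider "i \<in> S'" "j \<in> S'" | "i \<in> T'" "j \<in> T'" |
        "i \<in> S' - C" "j \<in> C - S'" | "j \<in> S' - C" "i \<in> C - S'"
        using \<open>C - S' \<subseteq> T'\<close> by auto
      then show False
      proof cases
        case 1
        then show False using e ij stable_sets_no_link[OF S'(1)] by blast
      next
        case 2
        then show False using e ij stable_sets_no_link[OF S'(2)] by blast
      next
        case 3
        then show False using e ij no_link by blast
      next
        case 4
        then have "{j, i} \<notin> snd G" by (rule no_link)
        then show False using e ij by (simp add: insert_commute)
      qed
    qed
    moreover have "(S' - C) \<union> (C - S') \<subseteq> fst G"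
      using S' \<open>C - S' \<subseteq> T'\<close> by (auto simp: stable_sets_def)
    ultimately show ?thesis by (auto simp: stable_sets_def)
  qed
  define W where "W = (S - C) \<union> (C - S)"
  define Z where "Z = (T - C) \<union> (C - T)"
  have WZ: "W \<in> stable_sets G" "Z \<in> stable_sets G"
    using exchange[of S T] exchange[of T S] by (simp_all add: W_def Z_def)
  have in_WZ: "i \<in> W \<and> i \<in> Z \<longleftrightarrow> i \<in> S \<and> i \<in> T" "i \<in> W \<or> i \<in> Z \<longleftrightarrow> i \<in> S \<or> i \<in> T" for i
    using C(1) by (auto simp: D_def W_def Z_def)
  have "incidence_vector S + incidence_vector T = incidence_vector W + incidence_vector Z"
  proof (rule poly_mapping_eqI)
    fix i
    show "Poly_Mapping.lookup (incidence_vector S + incidence_vector T) i =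
      Poly_Mapping.lookup (incidence_vector W + incidence_vector Z) i"
      using in_WZ[of i] by (auto simp: lookup_add
          lookup_incidence_vector[OF finite_stable_set[OF G]] S T WZ)
  qed
  then have "midpoint (incidence_vector S) (incidence_vector T) =
      midpoint (incidence_vector W) (incidence_vector Z)"
    by (simp add: midpoint_def)
  moreover have "W \<noteq> Z" "W \<notin> {S, T}" "Z \<notin> {S, T}"
  proof -
    obtain c where "c \<in> C" using C(2) by blast
    then have "c \<in> W \<longleftrightarrow> c \<notin> S" "c \<in> Z \<longleftrightarrow> c \<notin> T" "c \<in> S \<longleftrightarrow> c \<notin> T"
      using C(1) by (auto simp: D_def W_def Z_def)
    moreover obtain d where "d \<in> D" "d \<notin> C" using C(1,3) by blast
    then have "d \<in> W \<longleftrightarrow> d \<in> S" "d \<in> Z \<longleftrightarrow> d \<in> T" "d \<in> S \<longleftrightarrow> d \<notin> T"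
      by (auto simp: D_def W_def Z_def)
    ultimately show "W \<noteq> Z" "W \<notin> {S, T}" "Z \<notin> {S, T}" by blast+
  qed
  ultimately show ?thesis using WZ that by blast
qed

text \<open>In the disconnected case the segment is not a face, since it shares its midpoint with the
  segment of an exchanged pair, whose ends are vertices not on it.\<close>

lemma adjacent_iff_connected:
  assumes G: "finite_simple_graph G"
    and S: "S \<in> stable_sets G" and T: "T \<in> stable_sets G" and ST: "S \<noteq> T"
  shows "{incidence_vector S, incidence_vector T} \<in> snd (skeleton (stable_set_polytope G))
    \<longleftrightarrow> connected_on G ((S - T) \<union> (T - S))"
proof
  let ?P = "stable_set_polytope G"
  let ?seg = "closed_segment (incidence_vector S) (incidence_vector T)"
  assume "{incidence_vector S, incidence_vector T} \<in> snd (skeleton ?P)"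
  then obtain u v where "{incidence_vector S, incidence_vector T} = {u, v}"
    and "closed_segment u v face_of ?P"
    by (auto simp: skeleton_def edge_of_polytope_def)
  then have face: "?seg face_of ?P"
    by (metis closed_segment_commute doubleton_eq_iff)
  show "connected_on G ((S - T) \<union> (T - S))"
  proof (rule ccontr)
    assume "\<not> connected_on G ((S - T) \<union> (T - S))"
    then obtain W Z where W: "W \<in> stable_sets G" and Z: "Z \<in> stable_sets G"
      and "W \<noteq> Z" "W \<notin> {S, T}"
      and mid: "midpoint (incidence_vector S) (incidence_vector T) =
        midpoint (incidence_vector W) (incidence_vector Z)"
      by (rule exchange_of_disconnected[OF G S T])
    note eq_iff = incidence_vector_eq_iff[OF finite_stable_set[OF G] finite_stable_set[OF G]]
    have "midpoint (incidence_vector S) (incidence_vector T) \<in>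
        open_segment (incidence_vector W) (incidence_vector Z)"
      using \<open>W \<noteq> Z\<close> by (simp add: mid eq_iff W Z)
    then have "incidence_vector W \<in> ?seg"
      using face incidence_vector_in_stable_set_polytope[OF W]
        incidence_vector_in_stable_set_polytope[OF Z] midpoint_in_closed_segment
      unfolding face_of_def by blast
    moreover have "incidence_vector W \<notin> {incidence_vector S, incidence_vector T}"
      using \<open>W \<notin> {S, T}\<close> by (simp add: eq_iff W S T)
    ultimately have "incidence_vector W \<in> open_segment (incidence_vector S) (incidence_vector T)"
      by (simp add: open_segment_def)
    moreover have "incidence_vector W extreme_point_of ?P"
      using W by (simp add: extreme_point_of_stable_set_polytope[OF G])
    ultimately show False
      using incidence_vector_in_stable_set_polytope[OF S]
        incidence_vector_in_stable_set_polytope[OF T]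
      unfolding extreme_point_of_def by blast
  qed
next
  let ?P = "stable_set_polytope G"
  let ?seg = "closed_segment (incidence_vector S) (incidence_vector T)"
  assume "connected_on G ((S - T) \<union> (T - S))"
  then have "?seg face_of ?P"
    using segment_face_of_stable_set_polytope[OF G S T ST] by blast
  moreover have "has_dimension ?seg 1"
  proof -
    have "affine hull {incidence_vector S, incidence_vector T} = affine hull ?seg"
      by (simp add: segment_convex_hull)
    moreover have "card {incidence_vector S, incidence_vector T} = 1 + 1"
      using ST incidence_vector_eq_iff[OF finite_stable_set[OF G S] finite_stable_set[OF G T]]
      by simp
    ultimately show ?thesis
      unfolding has_dimension_def using affine_independent_2 by blast
  qed
  ultimately show "{incidence_vector S, incidence_vector T} \<in> snd (skeleton ?P)"
    by (auto simp: skeleton_def edge_of_polytope_def)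
qed

section \<open>Properties of the stable set polytope\<close>

lemma has_dimension_stable_set_polytope:
  assumes G: "finite_simple_graph G"
  shows "has_dimension (stable_set_polytope G) (card (fst G))"
proof -
  define U where "U = (\<lambda>i. Poly_Mapping.single i (1::real)) ` fst G"
  have fin: "finite (fst G)" using G by (simp add: finite_simple_graph_def)
  have inj: "inj_on (\<lambda>i. Poly_Mapping.single i (1::real)) (fst G)"
    by (rule inj_onI) (metis lookup_single_eq lookup_single_not_eq one_neq_zero)
  have "0 \<notin> U"
    by (auto simp: U_def) (metis lookup_single_eq lookup_zero zero_neq_one)
  have vec_empty: "incidence_vector {} = (0 :: 'a \<Rightarrow>\<^sub>0 real)"
    by (simp add: incidence_vector_def)
  have span: "affine hull (insert 0 U) = span U"
    using affine_hull_span_0[of "insert 0 U"] by (simp add: hull_inc span_insert_0)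
  have "affine hull (insert 0 U) = affine hull (stable_set_polytope G)"
  proof
    have "insert 0 U \<subseteq> incidence_vector ` stable_sets G"
    proof -
      have "incidence_vector {i} \<in> incidence_vector ` stable_sets G" if "i \<in> fst G" for i
        using singleton_in_stable_sets[OF G that] by blast
      moreover have "incidence_vector {} \<in> incidence_vector ` stable_sets G"
        using empty_in_stable_sets[OF G] by blast
      ultimately show ?thesis
        unfolding vec_empty by (auto simp: U_def incidence_vector_def)
    qed
    then show "affine hull (insert 0 U) \<subseteq> affine hull (stable_set_polytope G)"
      by (simp add: stable_set_polytope_def hull_mono)
  next
    have "incidence_vector S \<in> span U" if "S \<in> stable_sets G" for S
      unfolding incidence_vector_def
      by (rule span_sum, rule span_base) (use that in \<open>auto simp: U_def stable_sets_def\<close>)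
    then have "incidence_vector ` stable_sets G \<subseteq> affine hull (insert 0 U)"
      unfolding span by blast
    then show "affine hull (stable_set_polytope G) \<subseteq> affine hull (insert 0 U)"
      by (simp add: stable_set_polytope_def hull_minimal)
  qed
  moreover have "\<not> affine_dependent (insert 0 U)"
  proof -
    have "independent U"
    proof (rule independent_if_scalars_zero)
      show "finite U" by (simp add: U_def fin)
      fix f :: "('a \<Rightarrow>\<^sub>0 real) \<Rightarrow> real" and x
      assume sum0: "(\<Sum>x\<in>U. f x *\<^sub>R x) = 0" and "x \<in> U"
      then obtain k where k: "k \<in> fst G" "x = Poly_Mapping.single k 1" by (auto simp: U_def)
      have "0 = Poly_Mapping.lookup (\<Sum>x\<in>U. f x *\<^sub>R x) k" by (simp add: sum0)
      also have "\<dots> = (\<Sum>i\<in>fst G. f (Poly_Mapping.single i 1) * (if i = k then 1 else 0))"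
        by (simp add: U_def sum.reindex[OF inj] lookup_sum lookup_scaleR lookup_single when_def)
      also have "\<dots> = f x"
        using k fin by (simp add: if_distrib[of "\<lambda>z. _ * z"] cong: if_cong)
      finally show "f x = 0" by simp
    qed
    then show ?thesis
      using affine_dependent_iff_dependent[OF \<open>0 \<notin> U\<close>] by simp
  qed
  moreover have "card (insert 0 U) = card (fst G) + 1"
    using \<open>0 \<notin> U\<close> fin by (simp add: U_def card_image[OF inj])
  ultimately show ?thesis unfolding has_dimension_def by blast
qed

lemma binary_stable_set_polytope:
  fixes G :: "nat graph"
  assumes "finite_simple_graph G"
  shows "binary_polytope (stable_set_polytope G)"
  unfolding binary_polytope_def extreme_point_of_stable_set_polytope[OF assms]
  using lookup_incidence_vector[OF finite_stable_set[OF assms]] by auto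

lemma combinatorial_stable_set_polytope:
  fixes G :: "nat graph"
  assumes G: "finite_simple_graph G"
  shows "combinatorial_polytope (stable_set_polytope G)"
  unfolding combinatorial_polytope_def
proof (intro conjI allI impI)
  let ?P = "stable_set_polytope G"
  show "binary_polytope ?P" by (rule binary_stable_set_polytope[OF G])
  fix u v
  assume uv: "u extreme_point_of ?P \<and> v extreme_point_of ?P \<and> u \<noteq> v \<and>
    {u, v} \<notin> snd (skeleton ?P)"
  then obtain S T where S: "S \<in> stable_sets G" "u = incidence_vector S"
    and T: "T \<in> stable_sets G" "v = incidence_vector T"
    by (auto simp: extreme_point_of_stable_set_polytope[OF G])
  with uv have "\<not> connected_on G ((S - T) \<union> (T - S))"
    using adjacent_iff_connected[OF G S(1) T(1)] by auto
  from exchange_of_disconnected[OF G S(1) T(1) this]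
  obtain W Z where WZ: "W \<in> stable_sets G" "Z \<in> stable_sets G" "W \<noteq> Z"
    "W \<notin> {S, T}" "Z \<notin> {S, T}"
    "midpoint u v = midpoint (incidence_vector W) (incidence_vector Z)"
    unfolding S(2) T(2) .
  show "\<exists>w z. w extreme_point_of ?P \<and> z extreme_point_of ?P \<and> w \<noteq> z \<and>
      w \<notin> {u, v} \<and> z \<notin> {u, v} \<and> midpoint u v = midpoint w z"
    by (rule exI[of _ "incidence_vector W"], rule exI[of _ "incidence_vector Z"])
      (use WZ in \<open>simp add: extreme_point_of_stable_set_polytope[OF G] S T
        incidence_vector_eq_iff[OF finite_stable_set[OF G] finite_stable_set[OF G]]\<close>)
qed

lemma stable_set_polytope_subset_coord_space:
  assumes "finite_simple_graph G" "fst G \<subseteq> {..<m}"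
  shows "stable_set_polytope G \<subseteq> coord_space m"
proof
  fix x assume "x \<in> stable_set_polytope G"
  then have "Poly_Mapping.keys x \<subseteq> fst G"
    using stable_set_polytope_outside[OF assms(1)] by (auto simp: in_keys_iff)
  with assms(2) show "x \<in> coord_space m" by (auto simp: coord_space_def)
qed

lemma graph_isomorphic_singletons:
  fixes G :: "'a graph"
  assumes G: "finite_simple_graph G"
  defines "P \<equiv> stable_set_polytope G"
  defines "N \<equiv> (\<lambda>i. incidence_vector {i}) ` fst G"
  shows "induced_subgraph (N, {e \<in> snd (skeleton P). e \<subseteq> N}) (skeleton P)"
    and "graph_isomorphic G (N, {e \<in> snd (skeleton P). e \<subseteq> N})"
proof -
  note sing = singleton_in_stable_sets[OF G]
  show "induced_subgraph (N, {e \<in> snd (skeleton P). e \<subseteq> N}) (skeleton P)"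
    using sing by (auto simp: induced_subgraph_def skeleton_def N_def P_def
        extreme_point_of_stable_set_polytope[OF G])
  have "bij_betw (\<lambda>i. incidence_vector {i}) (fst G) N"
    unfolding N_def by (rule inj_on_imp_bij_betw) (simp add: inj_on_def incidence_vector_eq_iff)
  moreover have "{u, v} \<in> snd G \<longleftrightarrow> {incidence_vector {u}, incidence_vector {v}} \<in> snd (skeleton P)"
    if uv: "u \<in> fst G" "v \<in> fst G" for u v
  proof (cases "u = v")
    case True
    \<comment> \<open>A single node is a link of neither graph.\<close>
    have "finite_simple_graph (skeleton P)"
      unfolding P_def by (intro skeleton_finite_simple_graph polytope_stable_set_polytope G)
    with G True show ?thesis by (auto simp: finite_simple_graph_def)
  next
    case False
    then have "({u} - {v}) \<union> ({v} - {u}) = {u, v}" by auto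
    with False show ?thesis
      using adjacent_iff_connected[OF G sing[OF uv(1)] sing[OF uv(2)]]
      by (simp add: P_def connected_on_doubleton)
  qed
  ultimately show "graph_isomorphic G (N, {e \<in> snd (skeleton P). e \<subseteq> N})"
    unfolding graph_isomorphic_def
    by (intro exI[of _ "\<lambda>i. incidence_vector {i}"]) (auto simp: N_def)
qed

section \<open>Every graph in the skeleton of a combinatorial polytope\<close>

lemma graph_isomorphic_trans:
  assumes "graph_isomorphic G H" "graph_isomorphic H K"
  shows "graph_isomorphic G K"
proof -
  obtain f where f: "bij_betw f (fst G) (fst H)"
    "\<forall>u\<in>fst G. \<forall>v\<in>fst G. {u, v} \<in> snd G \<longleftrightarrow> {f u, f v} \<in> snd H"
    using assms(1) by (auto simp: graph_isomorphic_def)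
  obtain g where g: "bij_betw g (fst H) (fst K)"
    "\<forall>u\<in>fst H. \<forall>v\<in>fst H. {u, v} \<in> snd H \<longleftrightarrow> {g u, g v} \<in> snd K"
    using assms(2) by (auto simp: graph_isomorphic_def)
  have "bij_betw (g \<circ> f) (fst G) (fst K)" using f(1) g(1) by (rule bij_betw_trans)
  moreover have "f u \<in> fst H" if "u \<in> fst G" for u using f(1) that by (rule bij_betwE[rule_format])
  ultimately show ?thesis
    unfolding graph_isomorphic_def using f(2) g(2) by (intro exI[of _ "g \<circ> f"]) simp
qed

text \<open>The ambient space has its coordinates indexed by natural numbers, hence the relabelling.\<close>

lemma exists_isomorphic_nat_graph:
  assumes G: "finite_simple_graph G"
  obtains H :: "nat graph" where "finite_simple_graph H" "fst H = {..<card (fst G)}"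
    "graph_isomorphic G H"
proof -
  obtain f where f: "bij_betw f (fst G) {..<card (fst G)}"
    using G ex_bij_betw_finite_nat[of "fst G"]
    by (auto simp: finite_simple_graph_def atLeast0LessThan)
  have inj: "inj_on f (fst G)" and img: "f ` fst G = {..<card (fst G)}"
    using f by (auto simp: bij_betw_def)
  define H where "H = ({..<card (fst G)}, (`) f ` snd G)"
  have sub: "e \<subseteq> fst G" "card e = 2" if "e \<in> snd G" for e
    using G that by (auto simp: finite_simple_graph_def)
  have "finite_simple_graph H"
    using sub img inj by (fastforce simp: finite_simple_graph_def H_def card_image inj_on_subset)
  moreover have "{u, v} \<in> snd G \<longleftrightarrow> {f u, f v} \<in> snd H" if uv: "u \<in> fst G" "v \<in> fst G" for u v
  proof
    assume "{f u, f v} \<in> snd H"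
    then obtain e where e: "e \<in> snd G" "f ` {u, v} = f ` e" by (auto simp: H_def)
    then have "{u, v} = e"
      using inj_on_image_eq_iff[OF inj, of "{u, v}" e] uv sub(1) by auto
    with e show "{u, v} \<in> snd G" by simp
  next
    assume "{u, v} \<in> snd G"
    then have "f ` {u, v} \<in> snd H" unfolding H_def by (simp del: image_insert)
    then show "{f u, f v} \<in> snd H" by simp
  qed
  then have "graph_isomorphic G H"
    unfolding graph_isomorphic_def using f by (intro exI[of _ f]) (simp add: H_def)
  ultimately show ?thesis using that[of H] by (simp add: H_def)
qed

theorem mainTheorem2:
  fixes \<Gamma> :: "'a graph" and d :: nat
  assumes "d \<ge> 1"
    and "finite_simple_graph \<Gamma>"
    and "card (fst \<Gamma>) = d"
  shows "\<exists>m (P :: (nat \<Rightarrow>\<^sub>0 real) set).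
           P \<subseteq> coord_space m \<and> polytope P \<and> binary_polytope P \<and> combinatorial_polytope P \<and> has_dimension P d \<and>
           (\<exists>H. induced_subgraph H (skeleton P) \<and> graph_isomorphic \<Gamma> H)"
proof -
  obtain G :: "nat graph" where G: "finite_simple_graph G" "fst G = {..<d}"
    and iso: "graph_isomorphic \<Gamma> G"
    using exists_isomorphic_nat_graph[OF assms(2)] assms(3) by metis
  have "\<exists>H. induced_subgraph H (skeleton (stable_set_polytope G)) \<and> graph_isomorphic \<Gamma> H"
    using graph_isomorphic_singletons[OF G(1)] graph_isomorphic_trans[OF iso] by blast
  moreover have "stable_set_polytope G \<subseteq> coord_space d"
    using stable_set_polytope_subset_coord_space[OF G(1)] G(2) by simp
  moreover have "has_dimension (stable_set_polytope G) d"
    using has_dimension_stable_set_polytope[OF G(1)] G(2) by simp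
  ultimately show ?thesis
    using polytope_stable_set_polytope[OF G(1)] binary_stable_set_polytope[OF G(1)]
      combinatorial_stable_set_polytope[OF G(1)] by blast
qed

end
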